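(* For any $c\in\mathbb{F}$, the vertex algebra $V^0_{\mathcal{V}ir}(c,0)$ is $C_2$-cofinite.
   Context: $\mathbb{F}$ is an algebraically closed field of prime characteristic $p\ge 3$; all vector spaces are over $\mathbb{F}$. $\mathbb{N}$ denotes the nonnegative integers. Vertex algebras: a vertex algebra is a vector space $V$ with a linear map $Y(\cdot,x):V\to(\mathrm{End}\,V)[[x,x^{-1}]]$, $v\mapsto Y(v,x)=\sum_{n\in\mathbb{Z}}v_nx^{-n-1}$, and a vector $\mathbf 1\in V$ such that $Y(u,x)v\in V((x))$; $Y(\mathbf 1,x)=\mathrm{id}$; $Y(v,x)\mathbf 1\in V[[x]]$ with constant term $v$; and for $u,v,w\in V$ the Jacobi identity $x_0^{-1}\delta\left(\frac{x_1-x_2}{x_0}\right)Y(u,x_1)Y(v,x_2)w-x_0^{-1}\delta\left(\frac{x_2-x_1}{-x_0}\right)Y(v,x_2)Y(u,x_1)w=x_2^{-1}\delta\left(\frac{x_1-x_0}{x_2}\right)Y(Y(u,x_0)v,x_2)w$ holds, where $\delta(x)=\sum_{n\in\mathbb{Z}}x^n$ and $(x_1\pm x_2)^n$ is expanded in nonnegative powers of the second variable. An ideal is a subspace $I$ with $v_nw,\,w_nv\in I$ for all $v\in V$, $w\in I$, $n\in\mathbb{Z}$. $C_2$-cofiniteness: $C_2(V)=\mathrm{span}\{u_{-2-n}v\mid u,v\in V,\ n\in\mathbb{N}\}$, and $V$ is $C_2$-cofinite if $\dim V/C_2(V)<\infty$. Virasoro: $\mathcal{V}ir$ is the Lie algebra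 with basis $\{L_n\mid n\in\mathbb{Z}\}\cup\{\mathbf c\}$, $\mathbf c$ central, $[L_m,L_n]=(m-n)L_{m+n}+\frac12\binom{m+1}{3}\delta_{m+n,0}\mathbf c$. $V_{\mathcal{V}ir}(c,0)$ is the $\mathcal{V}ir$-module induced from the one-dimensional module of the subalgebra spanned by $\mathbf c$ and $L_n$ ($n\ge-1$), where $\mathbf c$ acts as $c$ and each $L_n$ ($n\ge -1$) acts as $0$; $\mathbf 1=1\otimes1$. It has a unique vertex algebra structure with vacuum $\mathbf 1$ and $Y(\omega,x)=\sum_{n\in\mathbb{Z}}L_nx^{-n-2}$, where $\omega=L_{-2}\mathbf 1$. Let $\delta_{p\mid n}=1$ if $p\mid n$ and $0$ otherwise. $I_0$ is the $\mathcal{V}ir$-submodule generated by $(L_{-n}^p-\delta_{p\mid n}L_{-np})\mathbf 1$ for $n\ge2$; it is an ideal, and $V^0_{\mathcal{V}ir}(c,0)=V_{\mathcal{V}ir}(c,0)/I_0$. *)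

theory Defs
  imports
    "HOL-Library.Poly_Mapping"
    "HOL-Algebra.Algebraic_Closure_Type"
begin

section \<open>Quotients, spans and finite dimension\<close>

text \<open>
  Vector spaces are modules in the sense of \<^locale>\<open>module\<close> over a ring \<open>R\<close> that is a field.
  The record type of modules extends that of rings; the ring multiplication and unit play no
  role for modules and are left unspecified here.
\<close>

definition quotient_module ::
    "('a, 'b, 'm) module_scheme \<Rightarrow> 'b set \<Rightarrow> ('a, 'b set) module" where
  "quotient_module M N =
     \<lparr>carrier = a_rcosets\<^bsub>M\<^esub> N, monoid.mult = undefined, one = undefined,
      ring.zero = N, add = set_add M,
      module.smult = (\<lambda>a A. \<Union>x\<in>A. N +>\<^bsub>M\<^esub> (a \<odot>\<^bsub>M\<^esub> x))\<rparr>"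

definition module_span ::
    "('a, 'r) ring_scheme \<Rightarrow> ('a, 'b, 'm) module_scheme \<Rightarrow> 'b set \<Rightarrow> 'b set" where
  "module_span R M S = (\<lambda>N. submodule N R M) hull S"

definition finite_dim ::
    "('a, 'r) ring_scheme \<Rightarrow> ('a, 'b, 'm) module_scheme \<Rightarrow> bool" where
  "finite_dim R M \<longleftrightarrow>
     (\<exists>B. finite B \<and> B \<subseteq> carrier M \<and> module_span R M B = carrier M)"


section \<open>Vertex algebras\<close>

text \<open>The integer-valued binomial coefficient with arbitrary integer upper argument. The notation
  \<open>gchoose\<close> cannot be used: its type is constrained to fields of characteristic zero.\<close>

definition int_binomial :: "int \<Rightarrow> nat \<Rightarrow> int" where
  "int_binomial m k = (\<Prod>i<k. m - int i) div fact k"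

text \<open>
  \<open>Y u n v\<close> is the value \<open>u\<^sub>n v\<close> of the \<open>n\<close>-th mode of \<open>u\<close>, so that
  \<open>Y(u,x)v = (\<Sum>n\<in>\<int>. u\<^sub>n v x\<^bsup>-n-1\<^esup>)\<close>. The Jacobi identity is stated as the equality of the
  coefficients of \<open>x\<^sub>0\<^bsup>-l-1\<^esup> x\<^sub>1\<^bsup>-m-1\<^esup> x\<^sub>2\<^bsup>-n-1\<^esup>\<close>, with \<open>(-1)\<^sup>i binom(-m-1+i, i)\<close>
  written as \<open>binom(m, i)\<close> on the right-hand side. By the truncation axiom only finitely
  many summands are nonzero, so the sum over all natural numbers \<open>i\<close> is the sum
  over \<open>i < N\<close> for every sufficiently large \<open>N\<close>. The integer coefficients act by
  repeated addition, since the binomial coefficients are formed before reduction modulo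
  the characteristic.
\<close>

locale vertex_algebra = field R + module R M
  for R :: "('a, 'r) ring_scheme" and M :: "('a, 'b, 'm) module_scheme" +
  fixes Y :: "'b \<Rightarrow> int \<Rightarrow> 'b \<Rightarrow> 'b" and vac :: 'b
  assumes mode_closed:
      "\<lbrakk>u \<in> carrier M; v \<in> carrier M\<rbrakk> \<Longrightarrow> Y u n v \<in> carrier M"
    and mode_add_left:
      "\<lbrakk>u \<in> carrier M; u' \<in> carrier M; v \<in> carrier M\<rbrakk>
        \<Longrightarrow> Y (u \<oplus>\<^bsub>M\<^esub> u') n v = Y u n v \<oplus>\<^bsub>M\<^esub> Y u' n v"
    and mode_smult_left:
      "\<lbrakk>a \<in> carrier R; u \<in> carrier M; v \<in> carrier M\<rbrakk>
        \<Longrightarrow> Y (a \<odot>\<^bsub>M\<^esub> u) n v = a \<odot>\<^bsub>M\<^esub> Y u n v"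
    and mode_add_right:
      "\<lbrakk>u \<in> carrier M; v \<in> carrier M; v' \<in> carrier M\<rbrakk>
        \<Longrightarrow> Y u n (v \<oplus>\<^bsub>M\<^esub> v') = Y u n v \<oplus>\<^bsub>M\<^esub> Y u n v'"
    and mode_smult_right:
      "\<lbrakk>a \<in> carrier R; u \<in> carrier M; v \<in> carrier M\<rbrakk>
        \<Longrightarrow> Y u n (a \<odot>\<^bsub>M\<^esub> v) = a \<odot>\<^bsub>M\<^esub> Y u n v"
    and truncation:
      "\<lbrakk>u \<in> carrier M; v \<in> carrier M\<rbrakk> \<Longrightarrow> \<exists>N. \<forall>n\<ge>N. Y u n v = \<zero>\<^bsub>M\<^esub>"
    and vac_closed: "vac \<in> carrier M"
    and vac_mode:
      "v \<in> carrier M \<Longrightarrow> Y vac n v = (if n = -1 then v else \<zero>\<^bsub>M\<^esub>)"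
    and creation_regular:
      "\<lbrakk>v \<in> carrier M; n \<ge> 0\<rbrakk> \<Longrightarrow> Y v n vac = \<zero>\<^bsub>M\<^esub>"
    and creation_const:
      "v \<in> carrier M \<Longrightarrow> Y v (-1) vac = v"
    and jacobi:
      "\<lbrakk>u \<in> carrier M; v \<in> carrier M; w \<in> carrier M\<rbrakk> \<Longrightarrow>
        \<forall>\<^sub>F N in sequentially.
          (\<Oplus>\<^bsub>M\<^esub>i\<in>{..<N::nat}. add_pow M ((-1) ^ i * int_binomial l i)
             (Y u (m + l - int i) (Y v (n + int i) w)
              \<ominus>\<^bsub>M\<^esub> add_pow M ((-1) ^ nat \<bar>l\<bar> :: int) (Y v (n + l - int i) (Y u (m + int i) w))))
          = (\<Oplus>\<^bsub>M\<^esub>i\<in>{..<N}. add_pow M (int_binomial m i)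
               (Y (Y u (l + int i) v) (m + n - int i) w))"

text \<open>\<open>quotient_modes M I Y Y'\<close>: the operations \<open>Y'\<close> are those of the quotient vertex
  algebra \<open>M/I\<close>, i.e. \<open>(u + I)\<^sub>n (v + I) = u\<^sub>n v + I\<close>. Such \<open>Y'\<close> exists, and is unique on
  \<open>M/I\<close>, when \<open>I\<close> is an ideal.\<close>

definition quotient_modes ::
    "('a, 'b, 'm) module_scheme \<Rightarrow> 'b set \<Rightarrow> ('b \<Rightarrow> int \<Rightarrow> 'b \<Rightarrow> 'b)
      \<Rightarrow> ('b set \<Rightarrow> int \<Rightarrow> 'b set \<Rightarrow> 'b set) \<Rightarrow> bool" where
  "quotient_modes M I Y Y' \<longleftrightarrow>
     (\<forall>u\<in>carrier M. \<forall>v\<in>carrier M. \<forall>n.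
        Y' (I +>\<^bsub>M\<^esub> u) n (I +>\<^bsub>M\<^esub> v) = I +>\<^bsub>M\<^esub> (Y u n v))"

definition C2_subspace ::
    "('a, 'r) ring_scheme \<Rightarrow> ('a, 'b, 'm) module_scheme \<Rightarrow> ('b \<Rightarrow> int \<Rightarrow> 'b \<Rightarrow> 'b) \<Rightarrow> 'b set" where
  "C2_subspace R M Y =
     module_span R M {Y u (- 2 - int n) v | u v n. u \<in> carrier M \<and> v \<in> carrier M}"

definition C2_cofinite ::
    "('a, 'r) ring_scheme \<Rightarrow> ('a, 'b, 'm) module_scheme \<Rightarrow> ('b \<Rightarrow> int \<Rightarrow> 'b \<Rightarrow> 'b) \<Rightarrow> bool" where
  "C2_cofinite R M Y \<longleftrightarrow> finite_dim R (quotient_module M (C2_subspace R M Y))"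


section \<open>The tensor algebra of the Virasoro algebra\<close>

datatype vir_basis = Vir_L int | Vir_c

text \<open>With concatenation as addition of words, the convolution product turns the finitely
  supported functions on words into the free associative algebra on the basis, that is, the
  tensor algebra of the vector space underlying the Virasoro algebra.\<close>

instantiation list :: (type) monoid_add
begin

definition zero_list :: "'a list" where "zero_list = []"

definition plus_list :: "'a list \<Rightarrow> 'a list \<Rightarrow> 'a list" where "plus_list = (@)"

instance by standard (simp_all add: zero_list_def plus_list_def)

end

type_synonym 'f vir_tensor = "vir_basis list \<Rightarrow>\<^sub>0 'f"

definition vir_scalar :: "'f::field \<Rightarrow> 'f vir_tensor" where
  "vir_scalar a = Poly_Mapping.single [] a"

definition vir_gen :: "vir_basis \<Rightarrow> 'f::field vir_tensor" where
  "vir_gen g = Poly_Mapping.single [g] 1"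

definition vir_tensor_module :: "('f::field, 'f vir_tensor) module" where
  "vir_tensor_module =
     \<lparr>carrier = UNIV, monoid.mult = (*), one = 1, ring.zero = 0, add = (+),
      module.smult = (\<lambda>a t. vir_scalar a * t)\<rparr>"

fun vir_bracket :: "vir_basis \<Rightarrow> vir_basis \<Rightarrow> 'f::field vir_tensor" where
  "vir_bracket (Vir_L m) (Vir_L n) =
     vir_scalar (of_int (m - n)) * vir_gen (Vir_L (m + n))
     + (if m + n = 0
        then vir_scalar (of_int (int_binomial (m + 1) 3) / 2) * vir_gen Vir_c else 0)"
| "vir_bracket Vir_c _ = 0"
| "vir_bracket _ Vir_c = 0"


section \<open>The vertex algebras of the Virasoro algebra\<close>

text \<open>
  The universal enveloping algebra \<open>U\<close> is the tensor algebra modulo the two-sided ideal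
  generated by the elements \<open>gh - hg - [g,h]\<close>. The induced module, i.e. the tensor product
  over \<open>U(span {\<^bold>c, L\<^sub>n | n \<ge> -1})\<close> of \<open>U\<close> with the one-dimensional module on which
  \<open>\<^bold>c\<close> acts as \<open>c\<close> and \<open>L\<^sub>n\<close> as \<open>0\<close>, is \<open>U\<close> modulo the left ideal generated by
  \<open>\<^bold>c - c\<close> and \<open>L\<^sub>n\<close> for \<open>n \<ge> -1\<close>. Both quotients are taken in one step.
\<close>

definition vir_relations :: "'f::field \<Rightarrow> 'f vir_tensor set" where
  "vir_relations c = module_span ring_of_type_algebra vir_tensor_module
     ({s * (vir_gen g * vir_gen h - vir_gen h * vir_gen g - vir_bracket g h) * t | s t g h. True}
      \<union> {s * vir_gen (Vir_L n) | s n. n \<ge> -1}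
      \<union> {s * (vir_gen Vir_c - vir_scalar c) | s. True})"

definition vir_module :: "'f::field \<Rightarrow> ('f, 'f vir_tensor set) module" where
  "vir_module c = quotient_module vir_tensor_module (vir_relations c)"

definition vir_vacuum :: "'f::field \<Rightarrow> 'f vir_tensor set" where
  "vir_vacuum c = vir_relations c +>\<^bsub>vir_tensor_module\<^esub> 1"

definition vir_action ::
    "'f::field \<Rightarrow> vir_basis \<Rightarrow> 'f vir_tensor set \<Rightarrow> 'f vir_tensor set" where
  "vir_action c g A = (\<Union>t\<in>A. vir_relations c +>\<^bsub>vir_tensor_module\<^esub> (vir_gen g * t))"

definition vir_omega :: "'f::field \<Rightarrow> 'f vir_tensor set" where
  "vir_omega c = vir_action c (Vir_L (-2)) (vir_vacuum c)"

text \<open>A vertex algebra structure on the induced module with vacuum \<open>\<^bold>1 = 1 \<otimes> 1\<close> and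
  \<open>Y(\<omega>,x) = (\<Sum>n\<in>\<int>. L\<^sub>n x\<^bsup>-n-2\<^esup>)\<close>, i.e. \<open>\<omega>\<^bsub>n+1\<^esub> = L\<^sub>n\<close>. There is exactly one.\<close>

definition vir_vertex_algebra ::
    "'f::field \<Rightarrow> ('f vir_tensor set \<Rightarrow> int \<Rightarrow> 'f vir_tensor set \<Rightarrow> 'f vir_tensor set) \<Rightarrow> bool" where
  "vir_vertex_algebra c Y \<longleftrightarrow>
     vertex_algebra ring_of_type_algebra (vir_module c) Y (vir_vacuum c) \<and>
     (\<forall>n. \<forall>v\<in>carrier (vir_module c).
        Y (vir_omega c) (n + 1) v = vir_action c (Vir_L n) v)"

definition vir_submodule :: "'f::field \<Rightarrow> 'f vir_tensor set set \<Rightarrow> bool" where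
  "vir_submodule c N \<longleftrightarrow>
     submodule N ring_of_type_algebra (vir_module c) \<and> (\<forall>g. \<forall>v\<in>N. vir_action c g v \<in> N)"

definition vir_I0 :: "'f::field \<Rightarrow> 'f vir_tensor set set" where
  "vir_I0 c = vir_submodule c hull
     {(vir_action c (Vir_L (- int n)) ^^ CHAR('f)) (vir_vacuum c)
        \<ominus>\<^bsub>vir_module c\<^esub>
        (if CHAR('f) dvd n
         then vir_action c (Vir_L (- int (n * CHAR('f)))) (vir_vacuum c)
         else \<zero>\<^bsub>vir_module c\<^esub>) | n. n \<ge> 2}"

text \<open>\<open>vir_I0 c\<close> is an ideal, so the modes of the vertex algebra on \<open>vir_module c\<close> induce
  operations on \<open>vir_module0 c\<close> in the sense of \<open>quotient_modes\<close>.\<close>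

definition vir_module0 :: "'f::field \<Rightarrow> ('f, 'f vir_tensor set set) module" where
  "vir_module0 c = quotient_module (vir_module c) (vir_I0 c)"

end

theory Submission
  imports Defs
begin

text \<open>
  Commuting generators past each other shows that the induced module is spanned by the words
  in the \<open>L\<^sub>m\<close>, \<open>m \<le> -2\<close>, applied to the vacuum. For \<open>n \<ge> 3\<close> the vector
  \<open>L\<^bsub>-n\<^esub> v = \<omega>\<^bsub>-2-(n-3)\<^esub> v\<close> lies in \<open>C\<^sub>2\<close>, so modulo \<open>C\<^sub>2\<close> only the powers of \<open>L\<^bsub>-2\<^esub>\<close>
  survive. Since \<open>p\<close> is odd, \<open>L\<^bsub>-2\<^esub>\<^sup>p \<^bold>1\<close> is one of the generators of \<open>I\<^sub>0\<close>, which
  leaves the images of \<open>L\<^bsub>-2\<^esub>\<^sup>k \<^bold>1\<close> with \<open>k < p\<close>. The argument takes place in the tensor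
  algebra: a subspace of the quotient is replaced by its preimage there.
\<close>

section \<open>Quotient modules\<close>

context module
begin

lemma submodule_abelian_subgroup:
  assumes "submodule N R M"
  shows "abelian_subgroup N M"
proof (rule abelian_subgroupI3)
  show "additive_subgroup N M"
    using assms by (simp add: additive_subgroup_def submodule_def)
qed (rule M.abelian_group_axioms)

lemma submodule_zero:
  assumes "submodule N R M"
  shows "\<zero>\<^bsub>M\<^esub> \<in> N"
  using subgroup.one_closed[OF submodule.axioms(1)[OF assms]] by simp

lemma submodule_Inter:
  assumes "\<And>N. N \<in> \<N> \<Longrightarrow> submodule N R M" and "\<N> \<noteq> {}"
  shows "submodule (\<Inter>\<N>) R M"
proof (rule submoduleI)
  show "\<Inter>\<N> \<subseteq> carrier M"
    using assms submoduleE(1) by blast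
  show "\<zero>\<^bsub>M\<^esub> \<in> \<Inter>\<N>"
    using assms(1) submodule_zero by blast
qed (use assms(1) submoduleE(3-5) in auto)

lemma submodule_module_span:
  assumes "S \<subseteq> carrier M"
  shows "submodule (module_span R M S) R M"
  unfolding module_span_def hull_def
  using assms carrier_is_submodule by (intro submodule_Inter) auto

text \<open>The quotient record defines scalar multiplication as a union over representatives. As
  \<open>N\<close> is closed under scalars, they all give the same coset and the union
  collapses.\<close>

lemma quotient_smult_coset:
  assumes N: "submodule N R M" and a: "a \<in> carrier R" and x: "x \<in> carrier M"
  shows "a \<odot>\<^bsub>quotient_module M N\<^esub> (N +>\<^bsub>M\<^esub> x) = N +>\<^bsub>M\<^esub> (a \<odot>\<^bsub>M\<^esub> x)"
proof -
  interpret N: abelian_subgroup N M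
    by (rule submodule_abelian_subgroup[OF N])
  have "N +>\<^bsub>M\<^esub> (a \<odot>\<^bsub>M\<^esub> y) = N +>\<^bsub>M\<^esub> (a \<odot>\<^bsub>M\<^esub> x)" if y: "y \<in> N +>\<^bsub>M\<^esub> x" for y
  proof -
    obtain n where n: "n \<in> N" "y = n \<oplus>\<^bsub>M\<^esub> x"
      using y by (auto simp: a_r_coset_def')
    then have "n \<in> carrier M"
      by simp
    then have "a \<odot>\<^bsub>M\<^esub> y = a \<odot>\<^bsub>M\<^esub> n \<oplus>\<^bsub>M\<^esub> a \<odot>\<^bsub>M\<^esub> x"
      using n a x by (simp add: smult_r_distr)
    moreover have "a \<odot>\<^bsub>M\<^esub> n \<in> N"
      using submoduleE(4)[OF N a n(1)] .
    ultimately have "a \<odot>\<^bsub>M\<^esub> y \<in> N +>\<^bsub>M\<^esub> (a \<odot>\<^bsub>M\<^esub> x)"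
      by (auto simp: a_r_coset_def')
    then show ?thesis
      using N.a_repr_independence'[of "a \<odot>\<^bsub>M\<^esub> y" "a \<odot>\<^bsub>M\<^esub> x"] a x by simp
  qed
  moreover have "x \<in> N +>\<^bsub>M\<^esub> x"
    using x by (rule N.a_rcos_self)
  ultimately have "(\<Union>y\<in>N +>\<^bsub>M\<^esub> x. N +>\<^bsub>M\<^esub> (a \<odot>\<^bsub>M\<^esub> y)) = N +>\<^bsub>M\<^esub> (a \<odot>\<^bsub>M\<^esub> x)"
    by blast
  then show ?thesis
    by (simp add: quotient_module_def)
qed

lemma quotient_add_coset:
  assumes "submodule N R M" "x \<in> carrier M" "y \<in> carrier M"
  shows "(N +>\<^bsub>M\<^esub> x) \<oplus>\<^bsub>quotient_module M N\<^esub> (N +>\<^bsub>M\<^esub> y) = N +>\<^bsub>M\<^esub> (x \<oplus>\<^bsub>M\<^esub> y)"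
  using abelian_subgroup.a_rcos_sum[OF submodule_abelian_subgroup[OF assms(1)] assms(2,3)]
  by (simp add: quotient_module_def)

lemma carrier_quotient_module:
  "carrier (quotient_module M N) = (\<lambda>x. N +>\<^bsub>M\<^esub> x) ` carrier M"
  by (auto simp: quotient_module_def A_RCOSETS_def')

lemma coset_of_mem:
  assumes "submodule N R M" "x \<in> N"
  shows "N +>\<^bsub>M\<^esub> x = N"
  by (rule abelian_subgroup.a_rcos_const[OF submodule_abelian_subgroup]) (rule assms)+

lemma module_quotient_module:
  assumes N: "submodule N R M"
  shows "module R (quotient_module M N)"
proof -
  let ?Q = "quotient_module M N"
  have zero: "\<zero>\<^bsub>?Q\<^esub> = N +>\<^bsub>M\<^esub> \<zero>\<^bsub>M\<^esub>"
    using coset_of_mem[OF N submodule_zero[OF N]] by (simp add: quotient_module_def)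
  have "abelian_group ?Q"
  proof (rule abelian_groupI)
    fix A assume "A \<in> carrier ?Q"
    then obtain x where "x \<in> carrier M" "A = N +>\<^bsub>M\<^esub> x"
      by (auto simp: carrier_quotient_module)
    then show "\<exists>Z\<in>carrier ?Q. Z \<oplus>\<^bsub>?Q\<^esub> A = \<zero>\<^bsub>?Q\<^esub>"
      by (intro bexI[of _ "N +>\<^bsub>M\<^esub> (\<ominus>\<^bsub>M\<^esub> x)"])
        (auto simp: carrier_quotient_module quotient_add_coset[OF N] zero M.l_neg)
  qed (auto simp: carrier_quotient_module quotient_add_coset[OF N] zero M.a_ac)
  then show ?thesis
  proof (rule moduleI[OF R.is_cring])
    fix A
    assume "A \<in> carrier ?Q"
    then obtain x where x: "x \<in> carrier M" "A = N +>\<^bsub>M\<^esub> x"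
      by (auto simp: carrier_quotient_module)
    show "\<one> \<odot>\<^bsub>?Q\<^esub> A = A"
      using x by (simp add: quotient_smult_coset[OF N])
    fix a
    assume a: "a \<in> carrier R"
    show "a \<odot>\<^bsub>?Q\<^esub> A \<in> carrier ?Q"
      using a x by (simp add: carrier_quotient_module quotient_smult_coset[OF N])
    show "(a \<oplus> b) \<odot>\<^bsub>?Q\<^esub> A = a \<odot>\<^bsub>?Q\<^esub> A \<oplus>\<^bsub>?Q\<^esub> b \<odot>\<^bsub>?Q\<^esub> A"
      "(a \<otimes> b) \<odot>\<^bsub>?Q\<^esub> A = a \<odot>\<^bsub>?Q\<^esub> (b \<odot>\<^bsub>?Q\<^esub> A)" if "b \<in> carrier R" for b
      using a that x by (simp_all add: quotient_smult_coset[OF N] quotient_add_coset[OF N]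
          smult_l_distr smult_assoc1)
    show "a \<odot>\<^bsub>?Q\<^esub> (A \<oplus>\<^bsub>?Q\<^esub> B) = a \<odot>\<^bsub>?Q\<^esub> A \<oplus>\<^bsub>?Q\<^esub> a \<odot>\<^bsub>?Q\<^esub> B" if "B \<in> carrier ?Q" for B
    proof -
      obtain y where "y \<in> carrier M" "B = N +>\<^bsub>M\<^esub> y"
        using \<open>B \<in> carrier ?Q\<close> by (auto simp: carrier_quotient_module)
      then show ?thesis
        using a x by (simp add: quotient_smult_coset[OF N] quotient_add_coset[OF N] smult_r_distr)
    qed
  qed
qed

text \<open>Together with the next lemma, this lets a subspace of the quotient be studied through
  representatives in \<open>M\<close>.\<close>

lemma submodule_coset_preimage:
  assumes N: "submodule N R M" and P: "submodule P R (quotient_module M N)"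
  shows "submodule {x \<in> carrier M. N +>\<^bsub>M\<^esub> x \<in> P} R M"
proof -
  interpret Q: module R "quotient_module M N"
    by (rule module_quotient_module[OF N])
  have zero: "N +>\<^bsub>M\<^esub> \<zero>\<^bsub>M\<^esub> \<in> P"
    using coset_of_mem[OF N] subgroup.one_closed[OF submodule.axioms(1)[OF P]]
      subgroup.one_closed[OF submodule.axioms(1)[OF N]]
    by (simp add: quotient_module_def)
  have smult: "N +>\<^bsub>M\<^esub> (a \<odot>\<^bsub>M\<^esub> x) \<in> P" if "a \<in> carrier R" "x \<in> carrier M" "N +>\<^bsub>M\<^esub> x \<in> P" for a x
    using Q.submoduleE(4)[OF P] quotient_smult_coset[OF N] that by metis
  have add: "N +>\<^bsub>M\<^esub> (x \<oplus>\<^bsub>M\<^esub> y) \<in> P"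
    if "x \<in> carrier M" "y \<in> carrier M" "N +>\<^bsub>M\<^esub> x \<in> P" "N +>\<^bsub>M\<^esub> y \<in> P" for x y
    using Q.submoduleE(5)[OF P] quotient_add_coset[OF N] that by metis
  have minus: "\<ominus>\<^bsub>M\<^esub> x = (\<ominus>\<^bsub>R\<^esub> \<one>\<^bsub>R\<^esub>) \<odot>\<^bsub>M\<^esub> x" if "x \<in> carrier M" for x
    using that by (simp add: smult_l_minus)
  show ?thesis
    by (rule submoduleI) (use zero smult add minus in auto)
qed

lemma subset_coset_preimage:
  assumes N: "submodule N R M" and P: "submodule P R (quotient_module M N)"
  shows "N \<subseteq> {x \<in> carrier M. N +>\<^bsub>M\<^esub> x \<in> P}"
  using coset_of_mem[OF N] submoduleE(1)[OF N] subgroup.one_closed[OF submodule.axioms(1)[OF P]]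
  by (auto simp: quotient_module_def)

text \<open>Spanning is phrased through all submodules above \<open>N\<close> and \<open>B\<close>,
  which avoids explicit linear combinations. The criterion is applied to the preimage of the span of
  the cosets of \<open>B\<close>.\<close>

lemma finite_dim_quotient_moduleI:
  assumes N: "submodule N R M" and B: "finite B" "B \<subseteq> carrier M"
    and gen: "\<And>P. \<lbrakk>submodule P R M; N \<subseteq> P; B \<subseteq> P\<rbrakk> \<Longrightarrow> carrier M \<subseteq> P"
  shows "finite_dim R (quotient_module M N)"
proof -
  let ?Q = "quotient_module M N" and ?B = "(\<lambda>x. N +>\<^bsub>M\<^esub> x) ` B"
  interpret Q: module R ?Q
    by (rule module_quotient_module[OF N])
  have sub: "?B \<subseteq> carrier ?Q"
    using B by (auto simp: carrier_quotient_module)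
  have P: "submodule (module_span R ?Q ?B) R ?Q"
    using sub by (rule Q.submodule_module_span)
  have "?B \<subseteq> module_span R ?Q ?B"
    unfolding module_span_def by (rule hull_subset)
  then have "carrier M \<subseteq> {x \<in> carrier M. N +>\<^bsub>M\<^esub> x \<in> module_span R ?Q ?B}"
    using B(2) by (intro gen submodule_coset_preimage subset_coset_preimage N P) auto
  then have "module_span R ?Q ?B = carrier ?Q"
    using Q.submoduleE(1)[OF P] by (auto simp: carrier_quotient_module)
  then show ?thesis
    unfolding finite_dim_def using B(1) sub by blast
qed

end

section \<open>Words in the Virasoro generators\<close>

lemma vir_scalar_mult: "vir_scalar a * vir_scalar b = vir_scalar (a * b)"
  by (simp add: vir_scalar_def mult_single plus_list_def)

lemma vir_scalar_add: "vir_scalar (a + b) = vir_scalar a + vir_scalar b"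
  by (simp add: vir_scalar_def single_add)

lemma vir_scalar_1: "vir_scalar 1 = 1"
  by (simp add: vir_scalar_def zero_list_def flip: single_one)

lemma vir_scalar_0: "vir_scalar 0 = 0"
  by (simp add: vir_scalar_def)

lemma vir_gen_scalar: "vir_gen g * vir_scalar a = vir_scalar a * vir_gen g"
  by (simp add: vir_scalar_def vir_gen_def mult_single plus_list_def)

lemma vir_gen_scalar_left: "vir_gen g * (vir_scalar a * t) = vir_scalar a * (vir_gen g * t)"
  by (metis mult.assoc vir_gen_scalar)

lemma vir_gen_power_scalar_left:
  "vir_gen g ^ k * (vir_scalar a * t) = vir_scalar a * (vir_gen g ^ k * t)"
  by (induction k) (simp_all add: mult.assoc vir_gen_scalar_left)

lemma carrier_vir_tensor_module [simp]: "carrier vir_tensor_module = UNIV"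
  by (simp add: vir_tensor_module_def)

lemma module_vir_tensor_module:
  "module (ring_of_type_algebra :: 'f ring) (vir_tensor_module :: ('f::field, 'f vir_tensor) module)"
proof (rule moduleI)
  show "cring (ring_of_type_algebra :: 'f ring)"
    by (rule cring_from_type_algebra)
  show "abelian_group (vir_tensor_module :: ('f, 'f vir_tensor) module)"
  proof (rule abelian_groupI)
    fix x :: "'f vir_tensor"
    show "\<exists>y\<in>carrier vir_tensor_module. y \<oplus>\<^bsub>vir_tensor_module\<^esub> x = \<zero>\<^bsub>vir_tensor_module\<^esub>"
      by (rule bexI[of _ "- x"]) (simp_all add: vir_tensor_module_def)
  qed (simp_all add: vir_tensor_module_def algebra_simps)
qed (simp_all add: vir_tensor_module_def ring_of_type_algebra_def vir_scalar_add vir_scalar_1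
      distrib_left distrib_right mult.assoc flip: vir_scalar_mult)

text \<open>A tensor is a finite linear combination of words, and a word arises by prepending
  letters to the empty word, which is \<open>1\<close>.\<close>

lemma vir_tensor_induct [case_names zero add scalar one gen]:
  fixes t :: "'f::field vir_tensor"
  assumes zero: "P 0" and add: "\<And>s t. P s \<Longrightarrow> P t \<Longrightarrow> P (s + t)"
    and scalar: "\<And>a t. P t \<Longrightarrow> P (vir_scalar a * t)"
    and one: "P 1" and gen: "\<And>g t. P t \<Longrightarrow> P (vir_gen g * t)"
  shows "P t"
proof (induction t rule: update_induct)
  case const
  then show ?case by (rule zero)
next
  case (update t w a)
  have word: "P (Poly_Mapping.single w 1)" for w
  proof (induction w)
    case Nil
    then show ?case using one by (simp add: zero_list_def flip: single_one)
  next
    case (Cons g w)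
    then show ?case using gen[of "Poly_Mapping.single w 1" g]
      by (simp add: vir_gen_def mult_single plus_list_def)
  qed
  \<comment> \<open>The word \<open>w\<close> is not yet a key of \<open>t\<close>, so overwriting
    its coefficient amounts to adding a term.\<close>
  have "Poly_Mapping.update w a t = t + vir_scalar a * Poly_Mapping.single w 1"
    using update by (intro poly_mapping_eqI)
      (auto simp: lookup_update lookup_add vir_scalar_def mult_single plus_list_def lookup_single
        in_keys_iff when_def)
  then show ?case using add scalar word update by simp
qed

section \<open>Submodules of the tensor algebra\<close>

text \<open>Translates closure properties of record-based submodules into the type class operations
  \<open>+\<close> and \<open>*\<close>.\<close>

locale vir_subspace =
  fixes P :: "'f::field vir_tensor set"
  assumes submodule: "submodule P ring_of_type_algebra vir_tensor_module"
begin

lemma zero_mem: "0 \<in> P"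
  using subgroup.one_closed[OF submodule.axioms(1)[OF submodule]]
  by (simp add: vir_tensor_module_def)

lemma add_mem: "s \<in> P \<Longrightarrow> t \<in> P \<Longrightarrow> s + t \<in> P"
  using module.submoduleE(5)[OF module_vir_tensor_module submodule, of s t]
  by (simp add: vir_tensor_module_def)

lemma scalar_mem: "t \<in> P \<Longrightarrow> vir_scalar a * t \<in> P"
  using module.submoduleE(4)[OF module_vir_tensor_module submodule, of a t]
  by (simp add: vir_tensor_module_def ring_of_type_algebra_def)

end

lemma submodule_vir_tensor_moduleI:
  fixes P :: "'f::field vir_tensor set"
  assumes "0 \<in> P" "\<And>s t. s \<in> P \<Longrightarrow> t \<in> P \<Longrightarrow> s + t \<in> P"
    and scalar: "\<And>a t. t \<in> P \<Longrightarrow> vir_scalar a * t \<in> P"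
  shows "submodule P ring_of_type_algebra vir_tensor_module"
proof -
  interpret T: module "ring_of_type_algebra :: 'f ring"
    "vir_tensor_module :: ('f, 'f vir_tensor) module"
    by (rule module_vir_tensor_module)
  have "\<ominus>\<^bsub>vir_tensor_module\<^esub> t \<in> P" if "t \<in> P" for t
  proof -
    have "\<ominus>\<^bsub>vir_tensor_module\<^esub> t = - t"
      by (rule T.minus_equality) (simp_all add: vir_tensor_module_def)
    moreover have "vir_scalar (- 1) + 1 = (0 :: 'f vir_tensor)"
      using vir_scalar_add[of "- 1 :: 'f" 1] by (simp add: vir_scalar_0 vir_scalar_1)
    then have "- t = vir_scalar (- 1) * t"
      by (simp add: eq_neg_iff_add_eq_0[symmetric])
    ultimately show ?thesis using scalar[OF that] by simp
  qed
  then show ?thesis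
    by (intro T.submoduleI) (use assms in \<open>simp_all add: vir_tensor_module_def\<close>)
qed

section \<open>The relations as a left ideal, and the Virasoro action on cosets\<close>

lemma submodule_vir_relations:
  "submodule (vir_relations c) ring_of_type_algebra vir_tensor_module"
  unfolding vir_relations_def
  by (rule module.submodule_module_span[OF module_vir_tensor_module]) simp

lemma vir_relations_incl:
  "s * (vir_gen g * vir_gen h - vir_gen h * vir_gen g - vir_bracket g h) * t \<in> vir_relations c"
  "n \<ge> -1 \<Longrightarrow> s * vir_gen (Vir_L n) \<in> vir_relations c"
  "s * (vir_gen Vir_c - vir_scalar c) \<in> vir_relations c"
  unfolding vir_relations_def module_span_def by (rule hull_inc; blast)+

text \<open>The relations are defined only as a linear span, but every spanning family carries an
  arbitrary left factor \<open>s\<close>, which absorbs \<open>u\<close>. Hence the subspace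
  \<open>?I\<close> contains all the spanning elements.\<close>

lemma vir_relations_left_ideal:
  assumes "t \<in> vir_relations c"
  shows "u * t \<in> vir_relations c"
proof -
  interpret vir_subspace "vir_relations c"
    by (rule vir_subspace.intro[OF submodule_vir_relations])
  let ?I = "{t. \<forall>u. u * t \<in> vir_relations c}"
  have "submodule ?I ring_of_type_algebra vir_tensor_module"
    by (rule submodule_vir_tensor_moduleI)
      (auto simp: zero_mem add_mem distrib_left simp flip: mult.assoc)
  then have "vir_relations c \<subseteq> ?I"
    by (subst vir_relations_def, subst module_span_def, intro hull_minimal)
      (auto simp: vir_relations_incl simp flip: mult.assoc)
  then show ?thesis
    using assms by blast
qed

abbreviation vir_coset :: "'f::field \<Rightarrow> 'f vir_tensor \<Rightarrow> 'f vir_tensor set" where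
  "vir_coset c t \<equiv> vir_relations c +>\<^bsub>vir_tensor_module\<^esub> t"

text \<open>By the left ideal property, left multiplication by a generator respects cosets, so the
  union defining the action is a single coset.\<close>

lemma vir_action_coset: "vir_action c g (vir_coset c t) = vir_coset c (vir_gen g * t)"
proof -
  interpret T: module "ring_of_type_algebra :: 'a ring"
    "vir_tensor_module :: ('a, 'a vir_tensor) module"
    by (rule module_vir_tensor_module)
  interpret R: abelian_subgroup "vir_relations c" vir_tensor_module
    by (rule T.submodule_abelian_subgroup[OF submodule_vir_relations])
  have "vir_coset c (vir_gen g * s) = vir_coset c (vir_gen g * t)" if "s \<in> vir_coset c t" for s
  proof -
    obtain r where r: "r \<in> vir_relations c" "s = r + t"
      using \<open>s \<in> vir_coset c t\<close> by (auto simp: a_r_coset_def' vir_tensor_module_def)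
    then have "vir_gen g * s \<in> vir_coset c (vir_gen g * t)"
      using vir_relations_left_ideal[OF r(1), of "vir_gen g"]
      by (auto simp: a_r_coset_def' vir_tensor_module_def distrib_left)
    then show ?thesis
      using R.a_repr_independence' by simp
  qed
  moreover have "t \<in> vir_coset c t"
    by (rule R.a_rcos_self) simp
  ultimately show ?thesis
    unfolding vir_action_def by blast
qed

lemma vir_action_funpow_vacuum:
  "(vir_action c g ^^ k) (vir_vacuum c) = vir_coset c (vir_gen g ^ k)"
  by (induction k) (simp_all add: vir_vacuum_def vir_action_coset)

text \<open>The span of the words in \<open>L\<^sub>m\<close>, \<open>m \<le> -2\<close>, applied to the vacuum, pulled back to the
  tensor algebra.\<close>

inductive_set vir_creation_span :: "'f::field \<Rightarrow> 'f vir_tensor set" for c :: 'f where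
  relation: "t \<in> vir_relations c \<Longrightarrow> t \<in> vir_creation_span c"
| one: "1 \<in> vir_creation_span c"
| add: "s \<in> vir_creation_span c \<Longrightarrow> t \<in> vir_creation_span c \<Longrightarrow> s + t \<in> vir_creation_span c"
| scalar: "t \<in> vir_creation_span c \<Longrightarrow> vir_scalar a * t \<in> vir_creation_span c"
| gen: "t \<in> vir_creation_span c \<Longrightarrow> m \<le> -2 \<Longrightarrow> vir_gen (Vir_L m) * t \<in> vir_creation_span c"

lemma zero_in_vir_creation_span: "0 \<in> vir_creation_span c"
  using vir_creation_span.scalar[OF vir_creation_span.one, of 0] by (simp add: vir_scalar_0)

text \<open>A bracket of generators is zero or a linear combination of generators, so the assumption
  on single generators suffices.\<close>

lemma vir_creation_span_bracket:
  assumes "\<And>h. vir_gen h * t \<in> vir_creation_span c"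
  shows "vir_bracket g h * t \<in> vir_creation_span c"
  using assms zero_in_vir_creation_span
  by (cases "(g, h)" rule: vir_bracket.cases)
    (auto simp: distrib_right mult.assoc intro!: vir_creation_span.add vir_creation_span.scalar)

text \<open>This is the spanning half of a PBW argument, without ordering the words. The induction
  keeps \<open>g\<close> arbitrary because moving \<open>g\<close> past a letter creates a bracket
  that involves other generators.\<close>

lemma vir_creation_span_gen:
  "t \<in> vir_creation_span c \<Longrightarrow> vir_gen g * t \<in> vir_creation_span c"
proof (induction arbitrary: g rule: vir_creation_span.induct)
  case (relation t)
  then show ?case
    by (intro vir_creation_span.relation vir_relations_left_ideal)
next
  case one
  show ?case
  proof (cases g)
    case (Vir_L m)
    show ?thesis
    proof (cases "m \<le> -2")
      case True
      then show ?thesis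
        using Vir_L vir_creation_span.gen[OF vir_creation_span.one] by simp
    next
      case False
      then show ?thesis
        using Vir_L vir_relations_incl(2)[of m 1 c] by (simp add: vir_creation_span.relation)
    qed
  next
    case Vir_c
    have "vir_gen Vir_c = (vir_gen Vir_c - vir_scalar c) + vir_scalar c * 1"
      by simp
    also have "\<dots> \<in> vir_creation_span c"
      using vir_relations_incl(3)[of 1 c]
      by (intro vir_creation_span.add vir_creation_span.scalar vir_creation_span.one)
        (simp add: vir_creation_span.relation)
    finally show ?thesis
      using Vir_c by simp
  qed
next
  case (add s t)
  then show ?case
    by (simp add: distrib_left vir_creation_span.add)
next
  case (scalar t a)
  then show ?case
    by (simp add: vir_gen_scalar_left vir_creation_span.scalar)
next
  case (gen t m)
  let ?L = "vir_gen (Vir_L m)"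
  \<comment> \<open>The first summand is a relation with left factor \<open>1\<close>; the other two
    are covered by the induction hypothesis for \<open>g\<close> and for the generators in the
    bracket.\<close>
  have "vir_gen g * (?L * t) = 1 * (vir_gen g * ?L - ?L * vir_gen g - vir_bracket g (Vir_L m)) * t
      + ?L * (vir_gen g * t) + vir_bracket g (Vir_L m) * t"
    by (simp add: algebra_simps)
  then show ?case
    using gen vir_relations_incl(1)[of 1 g "Vir_L m" t c] vir_creation_span_bracket
    by (metis vir_creation_span.intros(1,3,5))
qed

lemma vir_creation_span_UNIV: "t \<in> vir_creation_span c"
  by (induction t rule: vir_tensor_induct)
    (auto intro: zero_in_vir_creation_span vir_creation_span_gen vir_creation_span.intros)

text \<open>Modulo the image of the \<open>L\<^sub>n\<close> with \<open>n \<le> -3\<close>, which is stable under \<open>L\<^bsub>-2\<^esub>\<close>, every word in the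
  \<open>L\<^sub>m\<close>, \<open>m \<le> -2\<close>, is a power of \<open>L\<^bsub>-2\<^esub>\<close>.\<close>

lemma (in vir_subspace) eq_UNIV_of_powers:
  assumes rel: "vir_relations c \<subseteq> P"
    and low: "\<And>n t. n \<le> -3 \<Longrightarrow> vir_gen (Vir_L n) * t \<in> P"
    and pow: "\<And>k. vir_gen (Vir_L (-2)) ^ k \<in> P"
  shows "P = UNIV"
proof -
  let ?X = "vir_gen (Vir_L (-2)) :: 'f vir_tensor"
  \<comment> \<open>The rightmost \<open>?X\<close> is moved past the low generator. The bracket is
    a multiple of the generator of index \<open>n - 2\<close>, which is again low, so the induction
    runs over all \<open>n\<close> and \<open>t\<close>.\<close>
  have low_pow: "?X ^ k * (vir_gen (Vir_L n) * t) \<in> P" if "n \<le> -3" for k n t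
    using that
  proof (induction k arbitrary: n t)
    case 0
    then show ?case using low by simp
  next
    case (Suc k)
    let ?L = "vir_gen (Vir_L n) :: 'f vir_tensor"
    have "?X ^ Suc k * (?L * t) = ?X ^ k * (?X * ?L * t)"
      by (simp only: power_Suc2 mult.assoc)
    also have "\<dots> = ?X ^ k * (?X * ?L - ?L * ?X - vir_bracket (Vir_L (-2)) (Vir_L n)) * t
        + ?X ^ k * (?L * (?X * t)) + ?X ^ k * (vir_bracket (Vir_L (-2)) (Vir_L n) * t)"
      by (simp only: algebra_simps)
    \<comment> \<open>The central term is absent because \<open>-2 + n\<close> is negative.\<close>
    also have "vir_bracket (Vir_L (-2)) (Vir_L n)
        = (vir_scalar (of_int (-2 - n)) * vir_gen (Vir_L (-2 + n)) :: 'f vir_tensor)"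
      using Suc.prems by simp
    also have "?X ^ k * (?X * ?L - ?L * ?X
        - vir_scalar (of_int (-2 - n)) * vir_gen (Vir_L (-2 + n))) * t \<in> vir_relations c"
      using vir_relations_incl(1)[of "?X ^ k" "Vir_L (-2)" "Vir_L n" t c] Suc.prems by simp
    ultimately show ?case
      using Suc rel by (auto simp: mult.assoc vir_gen_power_scalar_left intro!: add_mem scalar_mem)
  qed
  \<comment> \<open>The free exponent \<open>k\<close> collects the leading letters of index
    \<open>-2\<close>; the first lower letter is settled by \<open>low_pow\<close>.\<close>
  have "?X ^ k * t \<in> P" for k t
    using vir_creation_span_UNIV[of t c]
  proof (induction arbitrary: k rule: vir_creation_span.induct)
    case (relation t)
    then show ?case using rel vir_relations_left_ideal by blast
  next
    case one
    then show ?case using pow by simp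
  next
    case (add s t)
    then show ?case by (simp add: distrib_left add_mem)
  next
    case (scalar t a)
    then show ?case by (simp add: vir_gen_power_scalar_left scalar_mem)
  next
    case (gen t m)
    show ?case
    proof (cases "m = -2")
      case True
      then show ?thesis using gen.IH[of "Suc k"] by (simp only: power_Suc2 mult.assoc)
    next
      case False
      then show ?thesis using gen low_pow by simp
    qed
  qed
  from this[of 0] show ?thesis by auto
qed

section \<open>The quotient by \<open>I\<^sub>0\<close>\<close>

lemma module_vir_module: "module ring_of_type_algebra (vir_module c)"
  unfolding vir_module_def
  by (rule module.module_quotient_module[OF module_vir_tensor_module submodule_vir_relations])

lemma carrier_vir_module: "carrier (vir_module c) = range (vir_coset c)"
  by (simp add: vir_module_def module.carrier_quotient_module[OF module_vir_tensor_module])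

lemma vir_submodule_vir_I0: "vir_submodule c (vir_I0 c)" for c :: "'f::field"
proof -
  interpret M: module "ring_of_type_algebra :: 'f ring" "vir_module c"
    by (rule module_vir_module)
  let ?S = "{(vir_action c (Vir_L (- int n)) ^^ CHAR('f)) (vir_vacuum c)
        \<ominus>\<^bsub>vir_module c\<^esub>
        (if CHAR('f) dvd n
         then vir_action c (Vir_L (- int (n * CHAR('f)))) (vir_vacuum c)
         else \<zero>\<^bsub>vir_module c\<^esub>) | n. n \<ge> 2}"
  let ?F = "{N. vir_submodule c N \<and> ?S \<subseteq> N}"
  \<comment> \<open>The whole carrier is a stable submodule containing the generators. This keeps
    the hull from being an intersection over an empty family, which would be all of
    \<open>UNIV\<close>.\<close>
  have "vir_submodule c (carrier (vir_module c))"
    using M.carrier_is_submodule by (auto simp: vir_submodule_def carrier_vir_module vir_action_coset)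
  moreover have "(vir_action c g ^^ k) (vir_vacuum c) \<in> carrier (vir_module c)"
    and "vir_action c g (vir_vacuum c) \<in> carrier (vir_module c)" for g k
    by (simp add: vir_action_funpow_vacuum carrier_vir_module,
        simp add: carrier_vir_module vir_vacuum_def vir_action_coset)
  then have "?S \<subseteq> carrier (vir_module c)"
    by (auto intro!: M.M.minus_closed M.M.zero_closed)
  ultimately have nonempty: "?F \<noteq> {}"
    by blast
  have "submodule (\<Inter>?F) ring_of_type_algebra (vir_module c)"
    by (rule M.submodule_Inter[OF _ nonempty]) (simp add: vir_submodule_def)
  then have "vir_submodule c (\<Inter>?F)"
    by (auto simp: vir_submodule_def)
  then show ?thesis
    unfolding vir_I0_def hull_def .
qed

text \<open>Since the characteristic \<open>p >= 3\<close> does not divide 2, the generator for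
  \<open>n = 2\<close> has no correction term and is the \<open>p\<close>-th power itself. Higher
  powers follow by stability under the action.\<close>

lemma power_in_vir_I0:
  fixes c :: "'f::field"
  assumes "CHAR('f) \<ge> 3" "k \<ge> CHAR('f)"
  shows "vir_coset c (vir_gen (Vir_L (-2)) ^ k) \<in> vir_I0 c"
proof -
  interpret M: module "ring_of_type_algebra :: 'f ring" "vir_module c"
    by (rule module_vir_module)
  let ?X = "vir_gen (Vir_L (-2)) :: 'f vir_tensor"
  have "\<not> CHAR('f) dvd 2"
    using assms(1) by (auto dest: dvd_imp_le)
  then have "(vir_action c (Vir_L (- int 2)) ^^ CHAR('f)) (vir_vacuum c) \<ominus>\<^bsub>vir_module c\<^esub> \<zero>\<^bsub>vir_module c\<^esub>
      \<in> vir_I0 c"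
    unfolding vir_I0_def by (intro hull_inc) (auto intro!: exI[of _ 2])
  moreover have "\<ominus>\<^bsub>vir_module c\<^esub> \<zero>\<^bsub>vir_module c\<^esub> = \<zero>\<^bsub>vir_module c\<^esub>"
    by (rule M.minus_equality) simp_all
  then have "vir_coset c t \<ominus>\<^bsub>vir_module c\<^esub> \<zero>\<^bsub>vir_module c\<^esub> = vir_coset c t" for t
    using M.M.r_zero[of "vir_coset c t"] by (simp add: a_minus_def carrier_vir_module)
  ultimately have "vir_coset c (?X ^ CHAR('f)) \<in> vir_I0 c"
    by (simp add: vir_action_funpow_vacuum)
  with \<open>k \<ge> CHAR('f)\<close> show ?thesis
  proof (induction k rule: dec_induct)
    case (step k)
    then have "vir_action c (Vir_L (-2)) (vir_coset c (?X ^ k)) \<in> vir_I0 c"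
      using vir_submodule_vir_I0 by (auto simp: vir_submodule_def)
    then show ?case
      by (simp add: vir_action_coset)
  qed
qed

theorem proposition4p6:
  fixes c :: "'f :: alg_closed_field"
  assumes "prime CHAR('f)" and "CHAR('f) \<ge> 3"
    and "vir_vertex_algebra c Y"
    and "quotient_modes (vir_module c) (vir_I0 c) Y Y0"
  shows "C2_cofinite ring_of_type_algebra (vir_module0 c) Y0"
proof -
  let ?R = "ring_of_type_algebra :: 'f ring"
  let ?T = "vir_tensor_module :: ('f, 'f vir_tensor) module"
  let ?M = "vir_module c" and ?I = "vir_I0 c" and ?V = "vir_module0 c"
  let ?X = "vir_gen (Vir_L (-2)) :: 'f vir_tensor"
  \<comment> \<open>The projection from the tensor algebra onto the final quotient, through both
    cosets at once.\<close>
  define q where "q t = ?I +>\<^bsub>?M\<^esub> vir_coset c t" for t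
  interpret V: vertex_algebra ?R ?M Y "vir_vacuum c"
    using assms(3) by (simp add: vir_vertex_algebra_def)
  interpret T: module ?R ?T
    by (rule module_vir_tensor_module)
  have I: "submodule ?I ?R ?M"
    using vir_submodule_vir_I0[of c] by (simp add: vir_submodule_def)
  interpret M0: module ?R ?V
    unfolding vir_module0_def by (rule V.module_quotient_module[OF I])
  have M0: "carrier ?V = range q"
    by (auto simp: vir_module0_def V.carrier_quotient_module carrier_vir_module q_def)
  \<comment> \<open>The span is known to be a submodule only once its generating set lies in the
    carrier.\<close>
  have "{Y0 u (- 2 - int n) v | u v n. u \<in> carrier ?V \<and> v \<in> carrier ?V} \<subseteq> carrier ?V"
    using assms(4) V.mode_closed
    by (auto simp: vir_module0_def V.carrier_quotient_module quotient_modes_def)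
  then have C2: "submodule (C2_subspace ?R ?V Y0) ?R ?V"
    unfolding C2_subspace_def by (rule M0.submodule_module_span)
  have omega: "vir_omega c = vir_coset c ?X"
    by (simp add: vir_omega_def vir_vacuum_def vir_action_coset)
  have low: "q (vir_gen (Vir_L n) * t) \<in> C2_subspace ?R ?V Y0" if "n \<le> -3" for n t
  proof -
    have "q (vir_gen (Vir_L n) * t) = ?I +>\<^bsub>?M\<^esub> Y (vir_omega c) (n + 1) (vir_coset c t)"
      using assms(3) by (simp add: vir_vertex_algebra_def carrier_vir_module vir_action_coset q_def)
    also have "\<dots> = Y0 (q ?X) (n + 1) (q t)"
      using assms(4) by (simp add: quotient_modes_def carrier_vir_module q_def omega)
    \<comment> \<open>The mode \<open>n + 1\<close> of \<open>omega\<close> acts as the generator of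
      index \<open>n\<close>. It equals \<open>-2 - j\<close> with \<open>j = -3 - n\<close>, a
      natural number exactly when \<open>n <= -3\<close>.\<close>
    also have "\<dots> = Y0 (q ?X) (- 2 - int (nat (- 3 - n))) (q t)"
      using that by (simp add: add.commute)
    also have "\<dots> \<in> C2_subspace ?R ?V Y0"
      unfolding C2_subspace_def module_span_def M0 by (rule hull_inc) blast
    finally show ?thesis .
  qed
  show ?thesis
    unfolding C2_cofinite_def
  proof (rule M0.finite_dim_quotient_moduleI[OF C2])
    let ?B = "(\<lambda>k. q (?X ^ k)) ` {..<CHAR('f)}"
    show "finite ?B" "?B \<subseteq> carrier ?V"
      by (auto simp: M0)
    fix P
    assume P: "submodule P ?R ?V" and C2P: "C2_subspace ?R ?V Y0 \<subseteq> P" and BP: "?B \<subseteq> P"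
    let ?PM = "{x \<in> carrier ?M. ?I +>\<^bsub>?M\<^esub> x \<in> P}"
    have P1: "submodule ?PM ?R ?M" and IP1: "?I \<subseteq> ?PM"
      using V.submodule_coset_preimage[OF I] V.subset_coset_preimage[OF I] P
      by (simp_all add: vir_module0_def)
    \<comment> \<open>\<open>P\<close> is pulled back twice, first along \<open>I0\<close> to
      \<open>?PM\<close> and then along the relations to the tensor algebra.\<close>
    let ?PT = "{t. q t \<in> P}"
    have P0: "?PT = {t \<in> carrier ?T. vir_coset c t \<in> ?PM}"
      by (simp add: q_def carrier_vir_module)
    interpret P0: vir_subspace ?PT
      unfolding P0 vir_subspace_def
      using P1 unfolding vir_module_def
      by (rule T.submodule_coset_preimage[OF submodule_vir_relations])
    have "?PT = UNIV"
    proof (rule P0.eq_UNIV_of_powers)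
      show "vir_relations c \<subseteq> ?PT"
        unfolding P0 using P1 unfolding vir_module_def
        by (rule T.subset_coset_preimage[OF submodule_vir_relations])
      show "vir_gen (Vir_L n) * t \<in> ?PT" if "n \<le> -3" for n t
        using low[OF that] C2P by blast
      \<comment> \<open>Exponents below the characteristic come from \<open>?B\<close>; all others
        give vectors of \<open>I0\<close>, which lies in \<open>?PM\<close>.\<close>
      show "?X ^ k \<in> ?PT" for k
        using BP power_in_vir_I0[OF assms(2), of k c] IP1
        by (cases "k < CHAR('f)") (auto simp: q_def)
    qed
    then show "carrier ?V \<subseteq> P"
      by (auto simp: M0)
  qed
qed

end
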